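(* There is an absolute constant $C>0$ such that for every (sufficiently large) prime $p$ and every integer $\lambda$ there exist positive integers $m,n,n_1,\ldots,n_{47}$ with $$\max\{m,n,n_1,\ldots,n_{47}\}\leqslant C\,p^{1300/1301}$$ such that $$m!\,n!+\sum_{i=1}^{47} n_i!\equiv \lambda \pmod p.$$
   Context: $p$ denotes a large prime. *)

theory Defs
  imports Complex_Main "HOL-Number_Theory.Cong" "HOL-Computational_Algebra.Primes"
begin

end

theory Submission
  imports Defs "HOL-Computational_Algebra.Polynomial" "HOL-Analysis.Convex" "HOL-Real_Asymp.Real_Asymp"
begin

text \<open>
  A linear relation between the factorials \<open>(n + 1)!, \<dots>, (n + H)!\<close> modulo \<open>p\<close> becomes, after division
  by \<open>n!\<close>, a polynomial equation of degree at most \<open>H\<close> in \<open>n\<close>, so it holds for at most \<open>H\<close> base points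
  \<open>n\<close>. Averaging over \<open>n \<le> N = p\<^bsup>1300/1301\<^esup>\<close> yields three windows of consecutive factorials which are
  nearly free of unwanted coincidences: one of length about \<open>N\<^bsup>1/24\<^esup>\<close> whose sums of 23 distinct terms
  are essentially distinct, giving about \<open>N\<^bsup>23/24\<^esup>\<close> residues; one of length \<open>K\<close>, about \<open>N\<^bsup>1/3\<^esup>\<close>, with
  additive energy \<open>O(K\<^sup>2)\<close>; and one of length \<open>D\<close>, about \<open>p\<^bsup>0.478\<^esup>\<close>, along which the equation
  \<open>a m! = a' m'!\<close> has few solutions when \<open>a, a'\<close> are weighted by the squared Fourier coefficients
  \<open>w(a)\<close> of the 23-fold sums.

  Let \<open>m\<close> run over the third window, \<open>n\<close> over the second, and take two 23-fold sums from the first.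
  By orthogonality of additive characters it suffices that \<open>\<Sum>\<^bsub>a \<noteq> 0\<^esub> w(a) \<Sum>\<^bsub>m\<^esub> \<bar>Y(a m!)\<bar>\<close> is smaller
  than the term \<open>a = 0\<close>, where \<open>Y\<close> is the exponential sum over the second window. Collecting the pairs
  \<open>(a, m)\<close> with the same \<open>b = a m!\<close> and applying the Cauchy-Schwarz inequality twice bounds this by the
  total weight, the weighted number of solutions of \<open>a m! = a' m'!\<close>, and the fourth moment of \<open>Y\<close>.
  The 47th factorial is \<open>1!\<close>.
\<close>

section \<open>Polynomial roots and linear relations between factorials modulo a prime\<close>

text \<open>Splitting off a linear factor preserves the leading coefficient, so the hypothesis on it
  passes to the quotient; primality of \<open>p\<close> makes a product vanish modulo
  \<open>p\<close> only when a factor does.\<close>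

lemma card_roots_mod_prime_le_degree:
  fixes f :: "int poly" and p :: nat
  assumes "prime p" "\<not> int p dvd lead_coeff f"
  shows "card {n. n < p \<and> int p dvd poly f (int n)} \<le> degree f"
  using assms(2)
proof (induction "degree f" arbitrary: f)
  case 0
  then obtain c where "f = [:c:]" by (metis degree_eq_zeroE)
  with 0 show ?case by simp
next
  case (Suc d)
  let ?Z = "\<lambda>f. {n. n < p \<and> int p dvd poly f (int n)}"
  show ?case
  proof (cases "?Z f = {}")
    case True
    then show ?thesis by (metis card.empty le0)
  next
    case False
    then obtain r where r: "r < p" "int p dvd poly f (int r)" by auto
    \<comment> \<open>A root modulo \<open>p\<close> need not be an integer root: the constant
      \<open>c\<close>, a multiple of \<open>p\<close>, is removed first, so that
      \<open>[:- int r, 1:]\<close> divides exactly.\<close>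
    define c where "c = poly f (int r)"
    have "[:- int r, 1:] dvd f - [:c:]"
      by (subst poly_eq_0_iff_dvd [symmetric]) (simp add: c_def)
    then obtain g where "f - [:c:] = [:- int r, 1:] * g" by (elim dvdE)
    then have f: "f = [:- int r, 1:] * g + [:c:]" by (simp add: algebra_simps)
    have g0: "g \<noteq> 0" using f Suc.hyps(2) by auto
    have deg: "degree ([:- int r, 1:] * g) = Suc (degree g)"
      using g0 by (subst degree_mult_eq) auto
    have degf: "degree f = Suc (degree g)"
      unfolding f using deg by (subst degree_add_eq_left) auto
    have "lead_coeff f = lead_coeff ([:- int r, 1:] * g)"
      unfolding degf using deg by (simp add: f)
    then have lead: "lead_coeff f = lead_coeff g"
      by (simp only: lead_coeff_mult) simp
    have IH: "card (?Z g) \<le> degree g"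
      using Suc lead degf by auto
    have "?Z f \<subseteq> insert r (?Z g)"
    proof
      fix n assume n: "n \<in> ?Z f"
      have "int p dvd (int n - int r) * poly g (int n)"
      proof -
        have "poly f (int n) - c = (int n - int r) * poly g (int n)"
          unfolding f by (simp add: algebra_simps)
        then show ?thesis using n r c_def by (metis dvd_diff mem_Collect_eq)
      qed
      then have "int p dvd int n - int r \<or> int p dvd poly g (int n)"
        using \<open>prime p\<close> by (simp add: prime_dvd_mult_iff)
      moreover have "n = r" if "int p dvd int n - int r"
        using that n r by (metis mem_Collect_eq mod_eq_dvd_iff mod_less of_nat_eq_iff zmod_int)
      ultimately show "n \<in> insert r (?Z g)" using n by auto
    qed
    then have "card (?Z f) \<le> card (insert r (?Z g))"
      by (intro card_mono) auto
    also have "\<dots> \<le> Suc (card (?Z g))" by (rule card_insert_le_m1) auto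
    finally show ?thesis using IH degf by simp
  qed
qed

definition rising_poly :: "nat \<Rightarrow> int poly" where
  "rising_poly h = (\<Prod>i=1..h. [:int i, 1:])"

lemma degree_rising_poly [simp]: "degree (rising_poly h) = h"
  unfolding rising_poly_def by (subst degree_prod_sum_eq) auto

lemma lead_coeff_rising_poly [simp]: "coeff (rising_poly h) h = 1"
proof -
  have "lead_coeff (rising_poly h) = 1"
    unfolding rising_poly_def by (simp only: lead_coeff_prod) simp
  then show ?thesis by simp
qed

lemma fact_add_eq_rising_poly: "(fact (n + h) :: int) = fact n * poly (rising_poly h) (int n)"
  by (induction h) (simp_all add: rising_poly_def algebra_simps)

text \<open>As \<open>n < p\<close>, the factor \<open>n!\<close> can be cancelled modulo
  \<open>p\<close>, leaving a polynomial in \<open>n\<close>. The rising factorials are monic of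
  distinct degrees, so the leading term cannot cancel.\<close>

lemma card_factorial_relation_le:
  fixes p N H h :: nat and c :: "nat \<Rightarrow> int"
  assumes "prime p" "N < p" "h \<in> {1..H}" "\<not> int p dvd c h"
  shows "card {n \<in> {1..N}. int p dvd (\<Sum>h=1..H. c h * fact (n + h))} \<le> H"
proof -
  \<comment> \<open>Only indices whose coefficient survives modulo \<open>p\<close> are kept; the
    largest of them, \<open>g\<close>, is then the degree of \<open>f\<close>, and
    \<open>c g\<close> its leading coefficient.\<close>
  define S where "S = {h \<in> {1..H}. \<not> int p dvd c h}"
  define g where "g = Max S"
  define f where "f = (\<Sum>h\<in>S. smult (c h) (rising_poly h))"
  have S: "finite S" "S \<noteq> {}" using assms by (auto simp: S_def)
  then have g: "g \<in> S" by (simp add: g_def)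
  have gH: "g \<le> H" "\<not> int p dvd c g" using g by (auto simp: S_def)
  have cg: "coeff f g = c g"
  proof -
    have "coeff f g = (\<Sum>h\<in>S. c h * coeff (rising_poly h) g)"
      by (simp add: f_def coeff_sum)
    also have "\<dots> = (\<Sum>h\<in>S. if h = g then c g else 0)"
    proof (rule sum.cong)
      fix h assume "h \<in> S"
      then have "h \<le> g" using S by (simp add: g_def)
      then show "c h * coeff (rising_poly h) g = (if h = g then c g else 0)"
        by (auto intro: coeff_eq_0)
    qed simp
    finally show ?thesis using S g by simp
  qed
  have "degree f \<le> g"
    unfolding f_def using S by (intro degree_sum_le) (auto simp: g_def intro: order_trans[OF degree_smult_le])
  moreover have "g \<le> degree f" using cg gH by (intro le_degree) auto
  ultimately have deg: "degree f = g" by simp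
  have "{n \<in> {1..N}. int p dvd (\<Sum>h=1..H. c h * fact (n + h))}
      \<subseteq> {n. n < p \<and> int p dvd poly f (int n)}"
  proof
    fix n assume n: "n \<in> {n \<in> {1..N}. int p dvd (\<Sum>h=1..H. c h * fact (n + h))}"
    then have "n < p" using assms by auto
    have "int p dvd (\<Sum>h\<in>{1..H} - S. c h * fact (n + h))"
      by (intro dvd_sum) (auto simp: S_def)
    moreover have "(\<Sum>h=1..H. c h * fact (n + h)) =
        (\<Sum>h\<in>{1..H} - S. c h * fact (n + h)) + (\<Sum>h\<in>S. c h * fact (n + h))"
      by (intro sum.subset_diff) (auto simp: S_def)
    ultimately have "int p dvd (\<Sum>h\<in>S. c h * fact (n + h))"
      using n by (simp add: dvd_add_right_iff)
    also have "(\<Sum>h\<in>S. c h * fact (n + h)) = fact n * poly f (int n)"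
      by (simp add: f_def poly_sum fact_add_eq_rising_poly sum_distrib_left mult_ac)
    finally have "int p dvd fact n \<or> int p dvd poly f (int n)"
      using \<open>prime p\<close> by (simp add: prime_dvd_mult_iff)
    moreover have "\<not> int p dvd fact n"
      using \<open>prime p\<close> \<open>n < p\<close> by (metis int_dvd_int_iff not_less of_nat_fact prime_dvd_fact_iff)
    ultimately show "n \<in> {n. n < p \<and> int p dvd poly f (int n)}" using \<open>n < p\<close> by simp
  qed
  then have "card {n \<in> {1..N}. int p dvd (\<Sum>h=1..H. c h * fact (n + h))}
      \<le> card {n. n < p \<and> int p dvd poly f (int n)}"
    by (intro card_mono) auto
  also have "\<dots> \<le> degree f"
    using assms cg deg gH by (intro card_roots_mod_prime_le_degree) auto
  finally show ?thesis using deg gH by simp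
qed

text \<open>The index \<open>q\<close> ranges over linear relations with weights \<open>v\<close>; the sum is over those relations
  that hold for the window based at \<open>n\<close>.\<close>

lemma exists_base_point:
  fixes p N H :: nat and c :: "'a \<Rightarrow> nat \<Rightarrow> int" and v :: "'a \<Rightarrow> real"
  assumes "prime p" "N < p" "1 \<le> N" "finite Q"
    and v: "\<And>q. q \<in> Q \<Longrightarrow> 0 \<le> v q"
    and nondeg: "\<And>q. q \<in> Q \<Longrightarrow> \<exists>h\<in>{1..H}. \<not> int p dvd c q h"
  shows "\<exists>n\<in>{1..N}. real N * (\<Sum>q | q \<in> Q \<and> int p dvd (\<Sum>h=1..H. c q h * fact (n + h)). v q)
           \<le> real H * (\<Sum>q\<in>Q. v q)"
proof (rule ccontr)
  let ?R = "\<lambda>n q. int p dvd (\<Sum>h=1..H. c q h * fact (n + h))"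
  let ?f = "\<lambda>n. \<Sum>q | q \<in> Q \<and> ?R n q. v q"
  assume "\<not> ?thesis"
  then have "real H * (\<Sum>q\<in>Q. v q) < real N * ?f n" if "n \<in> {1..N}" for n
    using that by (auto simp: not_le)
  then have "(\<Sum>n=1..N. real H * (\<Sum>q\<in>Q. v q)) < (\<Sum>n=1..N. real N * ?f n)"
    using assms by (intro sum_strict_mono) auto
  also have "\<dots> = real N * (\<Sum>n=1..N. \<Sum>q\<in>Q. if ?R n q then v q else 0)"
    using assms by (simp add: sum_distrib_left sum.inter_filter)
  finally have less: "real N * (real H * (\<Sum>q\<in>Q. v q))
      < real N * (\<Sum>n=1..N. \<Sum>q\<in>Q. if ?R n q then v q else 0)" by simp
  \<comment> \<open>Counted the other way round, each relation holds for at most \<open>H\<close>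
    base points, which contradicts the bound assumed at every \<open>n\<close>.\<close>
  have "(\<Sum>n=1..N. \<Sum>q\<in>Q. if ?R n q then v q else 0)
      = (\<Sum>q\<in>Q. \<Sum>n=1..N. if ?R n q then v q else 0)"
    by (rule sum.swap)
  also have "\<dots> = (\<Sum>q\<in>Q. real (card {n \<in> {1..N}. ?R n q}) * v q)"
    by (simp flip: sum.inter_filter)
  also have "\<dots> \<le> (\<Sum>q\<in>Q. real H * v q)"
  proof (intro sum_mono mult_right_mono)
    fix q assume q: "q \<in> Q"
    obtain h where "h \<in> {1..H}" "\<not> int p dvd c q h" using nondeg q by blast
    then show "real (card {n \<in> {1..N}. ?R n q}) \<le> real H"
      using card_factorial_relation_le[OF \<open>prime p\<close> \<open>N < p\<close>, of h H "c q"] by simp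
  qed (use v in auto)
  finally show False using less \<open>1 \<le> N\<close> by (simp flip: sum_distrib_left)
qed

section \<open>Additive characters and exponential sums modulo \<open>p\<close>\<close>

definition add_char :: "nat \<Rightarrow> int \<Rightarrow> complex" where
  "add_char p x = cis (2 * pi * real_of_int x / real p)"

lemma add_char_add: "add_char p (x + y) = add_char p x * add_char p y"
  by (simp add: add_char_def cis_mult ring_distribs add_divide_distrib)

lemma add_char_0 [simp]: "add_char p 0 = 1"
  by (simp add: add_char_def)

lemma norm_add_char [simp]: "cmod (add_char p x) = 1"
  by (simp add: add_char_def)

lemma cnj_add_char: "cnj (add_char p x) = add_char p (- x)"
  by (simp add: add_char_def cis_cnj)

lemma add_char_of_nat_mult: "add_char p (int a * x) = add_char p x ^ a"
  by (simp add: add_char_def DeMoivre mult_ac)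

lemma add_char_eq_1_iff:
  assumes "p > 0"
  shows "add_char p x = 1 \<longleftrightarrow> int p dvd x"
proof
  assume "add_char p x = 1"
  then have "cos (2 * pi * real_of_int x / real p) = 1"
    by (simp add: add_char_def complex_eq_iff)
  then obtain k :: int where "2 * pi * real_of_int x / real p = real_of_int k * 2 * pi"
    unfolding cos_one_2pi_int by blast
  then have "real_of_int x = real_of_int (int p * k)"
    using assms by (simp add: field_simps)
  then show "int p dvd x" by (metis dvd_triv_left of_int_eq_iff)
next
  assume "int p dvd x"
  then obtain k where "x = int p * k" by (elim dvdE)
  then have "2 * pi * real_of_int x / real p = 2 * pi * real_of_int k"
    using assms by simp
  then show "add_char p x = 1"
    by (simp only: add_char_def cis_multiple_2pi Ints_of_int)
qed

lemma add_char_mod: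
  assumes "p > 0"
  shows "add_char p (x mod int p * y) = add_char p (x * y)"
proof -
  have "add_char p (x * y) = add_char p (x mod int p * y + int p * (x div int p * y))"
    by (rule arg_cong[where f = "add_char p"])
       (metis add.commute distrib_right mult.assoc mult_div_mod_eq)
  also have "\<dots> = add_char p (x mod int p * y)"
    using add_char_eq_1_iff[OF assms, of "int p * (x div int p * y)"] by (simp add: add_char_add)
  finally show ?thesis by simp
qed

text \<open>Orthogonality of characters: the terms form a geometric progression whose ratio is a
  \<open>p\<close>-th root of unity.\<close>

lemma sum_add_char:
  assumes "p > 0"
  shows "(\<Sum>a\<in>{0..<int p}. add_char p (a * x)) = (if int p dvd x then of_nat p else 0)"
proof -
  have "(\<Sum>a\<in>{0..<int p}. add_char p (a * x)) = (\<Sum>a<p. add_char p x ^ a)"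
    by (rule sum.reindex_bij_witness[of _ int nat]) (auto simp flip: add_char_of_nat_mult)
  also have "\<dots> = (if int p dvd x then of_nat p else 0)"
  proof (cases "int p dvd x")
    case True
    then show ?thesis using add_char_eq_1_iff[OF assms, of x] by simp
  next
    case False
    then have "add_char p x \<noteq> 1" using add_char_eq_1_iff[OF assms] by simp
    moreover have "add_char p x ^ p = 1"
      using add_char_eq_1_iff[OF assms, of "int p * x"] by (simp add: add_char_of_nat_mult)
    ultimately show ?thesis using False by (simp add: geometric_sum)
  qed
  finally show ?thesis .
qed

text \<open>Indexing by \<open>I\<close>, instead of summing over a set of values, counts coinciding
  values with multiplicity.\<close>

definition exp_sum :: "nat \<Rightarrow> 'i set \<Rightarrow> ('i \<Rightarrow> int) \<Rightarrow> int \<Rightarrow> complex" where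
  "exp_sum p I f a = (\<Sum>i\<in>I. add_char p (a * f i))"

lemma norm_exp_sum_le: "cmod (exp_sum p I f a) \<le> real (card I)"
  unfolding exp_sum_def using norm_sum[of "\<lambda>i. add_char p (a * f i)" I] by simp

lemma exp_sum_0 [simp]: "exp_sum p I f 0 = of_nat (card I)"
  by (simp add: exp_sum_def)

lemma exp_sum_mod: "p > 0 \<Longrightarrow> exp_sum p I f (a mod int p) = exp_sum p I f a"
  by (simp add: exp_sum_def add_char_mod)

text \<open>Turns a fourth moment into the second moment of a sum over pairs, and factors sums over
  independent variables.\<close>

lemma exp_sum_mult:
  "exp_sum p I f a * exp_sum p J g a = exp_sum p (I \<times> J) (\<lambda>(i, j). f i + g j) a"
  by (simp add: exp_sum_def sum_product sum.cartesian_product add_char_add distrib_left case_prod_unfold)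

text \<open>Parseval's identity: the squared modulus is expanded over pairs, and orthogonality keeps
  only the coincidences modulo \<open>p\<close>.\<close>

lemma sum_norm_exp_sum_sq:
  assumes "p > 0" "finite I"
  shows "(\<Sum>a\<in>{0..<int p}. (cmod (exp_sum p I f a))\<^sup>2)
       = real p * real (card {(i, j). i \<in> I \<and> j \<in> I \<and> int p dvd f i - f j})"
proof -
  have "complex_of_real (\<Sum>a\<in>{0..<int p}. (cmod (exp_sum p I f a))\<^sup>2)
      = (\<Sum>a\<in>{0..<int p}. exp_sum p I f a * cnj (exp_sum p I f a))"
    unfolding of_real_sum by (intro sum.cong refl complex_norm_square)
  also have "\<dots> = (\<Sum>a\<in>{0..<int p}. \<Sum>(i, j)\<in>I \<times> I. add_char p (a * (f i - f j)))"
    by (simp add: exp_sum_def sum_product sum.cartesian_product cnj_add_char right_diff_distrib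
          flip: add_char_add)
  also have "\<dots> = (\<Sum>(i, j)\<in>I \<times> I. \<Sum>a\<in>{0..<int p}. add_char p (a * (f i - f j)))"
    by (subst sum.swap) (simp add: case_prod_unfold)
  also have "\<dots> = (\<Sum>q\<in>I \<times> I. if int p dvd f (fst q) - f (snd q) then of_nat p else 0)"
    using assms by (simp add: sum_add_char case_prod_unfold)
  also have "\<dots> = of_nat p * of_nat (card {q \<in> I \<times> I. int p dvd f (fst q) - f (snd q)})"
    using assms by (simp flip: sum.inter_filter)
  also have "{q \<in> I \<times> I. int p dvd f (fst q) - f (snd q)}
      = {(i, j). i \<in> I \<and> j \<in> I \<and> int p dvd f i - f j}" by auto
  finally have "complex_of_real (\<Sum>a\<in>{0..<int p}. (cmod (exp_sum p I f a))\<^sup>2)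
      = complex_of_real (real p * real (card {(i, j). i \<in> I \<and> j \<in> I \<and> int p dvd f i - f j}))"
    by simp
  then show ?thesis unfolding of_real_eq_iff .
qed

section \<open>Short windows of factorials with few coincidences\<close>

lemma sum_if_eq_mult:
  fixes f :: "'a \<Rightarrow> 'b :: semiring_0"
  assumes "finite S" "i \<in> S"
  shows "(\<Sum>h\<in>S. (if h = i then x else 0) * f h) = x * f i"
proof -
  have "(\<Sum>h\<in>S. (if h = i then x else 0) * f h) = (\<Sum>h\<in>S. if h = i then x * f i else 0)"
    by (rule sum.cong) auto
  then show ?thesis using assms by simp
qed

text \<open>Two distinct \<open>k\<close>-subsets give a relation with coefficients
  \<open>-1\<close>, \<open>0\<close>, \<open>1\<close>, not all zero. Averaging leaves at most
  \<open>(H choose k)^2 * H / N\<close> such coincidences, which \<open>small\<close> bounds by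
  \<open>H choose k\<close>; the pairs \<open>(A, A)\<close> give as many again.\<close>

lemma exists_window_few_subset_sum_collisions:
  fixes p N H k :: nat
  assumes "prime p" "N < p" "1 \<le> N" and small: "(H choose k) * H \<le> N"
  defines "I \<equiv> {A. A \<subseteq> {1..H} \<and> card A = k}"
  shows "\<exists>n\<in>{1..N}. card {(A, A'). A \<in> I \<and> A' \<in> I \<and>
            int p dvd (\<Sum>h\<in>A. fact (n + h)) - (\<Sum>h\<in>A'. fact (n + h))} \<le> 2 * (H choose k)"
proof -
  have I: "finite I" "card I = H choose k"
    unfolding I_def using n_subsets[of "{1..H}" k] by auto
  define Q where "Q = {q \<in> I \<times> I. fst q \<noteq> snd q}"
  define c where "c = (\<lambda>(A, A') (h :: nat). of_bool (h \<in> A) - of_bool (h \<in> A') :: int)"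
  have Q: "finite Q" "card Q \<le> (H choose k) * (H choose k)"
  proof -
    show "finite Q" using I by (simp add: Q_def)
    have "card Q \<le> card (I \<times> I)" using I by (intro card_mono) (auto simp: Q_def)
    then show "card Q \<le> (H choose k) * (H choose k)" using I by (simp add: card_cartesian_product)
  qed
  have nondeg: "\<exists>h\<in>{1..H}. \<not> int p dvd c q h" if "q \<in> Q" for q
  proof -
    obtain A A' where qA: "q = (A, A')" by (cases q)
    have q: "q = (A, A')" "A \<in> I" "A' \<in> I" "A \<noteq> A'"
      using that unfolding qA Q_def by auto
    then obtain h where h: "h \<in> {1..H}" "(h \<in> A) \<noteq> (h \<in> A')" unfolding I_def by blast
    have "\<not> int p dvd 1" "\<not> int p dvd - 1"
      using \<open>prime p\<close> prime_gt_1_nat by auto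
    then show ?thesis using h q by (intro bexI[of _ h]) (auto simp: c_def)
  qed
  obtain n where n: "n \<in> {1..N}"
    "real N * (\<Sum>q | q \<in> Q \<and> int p dvd (\<Sum>h=1..H. c q h * fact (n + h)). 1) \<le> real H * (\<Sum>q\<in>Q. 1)"
    using exists_base_point[OF assms(1-3) Q(1), of "\<lambda>_. 1" H c] nondeg by auto
  let ?X = "{q \<in> Q. int p dvd (\<Sum>h=1..H. c q h * fact (n + h))}"
  let ?Y = "{(A, A'). A \<in> I \<and> A' \<in> I \<and>
            int p dvd (\<Sum>h\<in>A. fact (n + h)) - (\<Sum>h\<in>A'. fact (n + h))}"
  have sub: "?Y \<subseteq> (\<lambda>A. (A, A)) ` I \<union> ?X"
  proof
    fix q assume "q \<in> ?Y"
    then obtain A A' where q: "q = (A, A')" "A \<in> I" "A' \<in> I"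
      "int p dvd (\<Sum>h\<in>A. fact (n + h)) - (\<Sum>h\<in>A'. fact (n + h))" by auto
    have restr: "(\<Sum>h=1..H. of_bool (h \<in> B) * fact (n + h)) = (\<Sum>h\<in>B. fact (n + h) :: int)"
      if "B \<in> I" for B
      using that by (intro sum.mono_neutral_cong_right) (auto simp: I_def)
    have "(\<Sum>h=1..H. c q h * fact (n + h)) = (\<Sum>h\<in>A. fact (n + h)) - (\<Sum>h\<in>A'. fact (n + h))"
      using restr q by (simp add: c_def left_diff_distrib sum_subtractf)
    then show "q \<in> (\<lambda>A. (A, A)) ` I \<union> ?X"
      using q by (auto simp: Q_def)
  qed
  have "N * card ?X \<le> H * card Q"
    using n(2) by (simp flip: of_nat_mult)
  also have "\<dots> \<le> (H choose k) * ((H choose k) * H)"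
    using Q(2) by (simp add: mult_ac)
  also have "\<dots> \<le> N * (H choose k)"
    using small by (metis mult.commute mult_le_mono1)
  finally have X: "card ?X \<le> (H choose k)"
    using \<open>1 \<le> N\<close> by simp
  have "card ?Y \<le> card ((\<lambda>A. (A, A)) ` I \<union> ?X)"
    using sub I Q by (intro card_mono) auto
  also have "\<dots> \<le> card ((\<lambda>A. (A, A)) ` I) + card ?X" by (rule card_Un_le)
  also have "\<dots> \<le> (H choose k) + (H choose k)"
    using X I card_image_le[of I "\<lambda>A. (A, A)"] by simp
  finally show ?thesis using n(1) by (intro bexI[of _ n]) auto
qed

text \<open>Each of the families \<open>s = r\<close> and \<open>s = prod.swap r\<close> contributes
  at most \<open>K^2\<close>; averaging bounds the contribution of the other pairs, at most
  \<open>K^4\<close> in number, by \<open>K^4 * K / N \<le> K^2\<close>.\<close>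

lemma exists_window_small_energy:
  fixes p N K :: nat
  assumes "prime p" "2 < p" "N < p" "1 \<le> N" and small: "K ^ 3 \<le> N"
  shows "\<exists>n\<in>{1..N}. card {(r, s). r \<in> {1..K} \<times> {1..K} \<and> s \<in> {1..K} \<times> {1..K} \<and>
            int p dvd (\<lambda>(i, j). fact (n + i) + fact (n + j)) r
              - (\<lambda>(i, j). fact (n + i) + fact (n + j)) s} \<le> 3 * K\<^sup>2"
proof -
  define P where "P = {1..K} \<times> {1..K}"
  have P: "finite P" "card P = K\<^sup>2" by (auto simp: P_def power2_eq_square)
  define Q where "Q = {q \<in> P \<times> P. fst q \<noteq> snd q \<and> fst q \<noteq> prod.swap (snd q)}"
  define c where "c = (\<lambda>((i, j), (i', j')) (h :: nat).
    of_bool (h = i) + of_bool (h = j) - of_bool (h = i') - of_bool (h = j') :: int)"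
  have Q: "finite Q" "card Q \<le> K\<^sup>2 * K\<^sup>2"
  proof -
    show "finite Q" using P by (simp add: Q_def)
    have "card Q \<le> card (P \<times> P)" using P by (intro card_mono) (auto simp: Q_def)
    then show "card Q \<le> K\<^sup>2 * K\<^sup>2" using P by (simp add: card_cartesian_product)
  qed
  have ndvd: "\<not> int p dvd x" if "x = 1 \<or> x = 2" for x
    using that \<open>2 < p\<close> zdvd_not_zless[of x "int p"] by auto
  have nondeg: "\<exists>h\<in>{1..K}. \<not> int p dvd c q h" if "q \<in> Q" for q
  proof -
    obtain i j i' j' where qi: "q = ((i, j), (i', j'))" by (metis surj_pair)
    have q: "q = ((i, j), (i', j'))" "i \<in> {1..K}" "j \<in> {1..K}"
      "\<not> (i = i' \<and> j = j')" "\<not> (i = j' \<and> j = i')"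
      using that unfolding qi Q_def P_def by auto
    \<comment> \<open>An index with uncancelled coefficient is needed. If \<open>i\<close> is
      matched by \<open>i'\<close> or \<open>j'\<close>, then \<open>j\<close> has coefficient
      \<open>1\<close>; otherwise \<open>i\<close> has coefficient \<open>1\<close>, or
      \<open>2\<close> when \<open>i = j\<close>, which is where \<open>2 < p\<close>
      enters.\<close>
    show ?thesis
    proof (cases "i = i' \<or> i = j'")
      case True
      then have "c q j = 1" using q by (auto simp: c_def)
      then show ?thesis using q(3) ndvd[of "c q j"] by blast
    next
      case False
      then have "c q i = 1 \<or> c q i = 2" using q by (auto simp: c_def)
      then show ?thesis using q(2) ndvd[of "c q i"] by blast
    qed
  qed
  obtain n where n: "n \<in> {1..N}"
    "real N * (\<Sum>q | q \<in> Q \<and> int p dvd (\<Sum>h=1..K. c q h * fact (n + h)). 1) \<le> real K * (\<Sum>q\<in>Q. 1)"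
    using exists_base_point[OF assms(1,3,4) Q(1), of "\<lambda>_. 1" K c] nondeg by auto
  let ?g = "\<lambda>(i, j). fact (n + i) + fact (n + j) :: int"
  let ?X = "{q \<in> Q. int p dvd (\<Sum>h=1..K. c q h * fact (n + h))}"
  let ?Y = "{(r, s). r \<in> P \<and> s \<in> P \<and> int p dvd ?g r - ?g s}"
  have sub: "?Y \<subseteq> (\<lambda>r. (r, r)) ` P \<union> (\<lambda>r. (r, prod.swap r)) ` P \<union> ?X"
  proof
    fix q assume q: "q \<in> ?Y"
    obtain i j i' j' where ij: "q = ((i, j), (i', j'))" by (metis surj_pair)
    have mem: "i \<in> {1..K}" "j \<in> {1..K}" "i' \<in> {1..K}" "j' \<in> {1..K}"
      using q unfolding ij P_def by auto
    have "(\<Sum>h=1..K. c q h * fact (n + h)) = ?g (i, j) - ?g (i', j')"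
      using mem by (simp add: ij c_def of_bool_def distrib_right left_diff_distrib sum_subtractf
          sum.distrib sum_if_eq_mult)
    then have "int p dvd (\<Sum>h=1..K. c q h * fact (n + h))"
      using q unfolding ij by simp
    then show "q \<in> (\<lambda>r. (r, r)) ` P \<union> (\<lambda>r. (r, prod.swap r)) ` P \<union> ?X"
      using q unfolding ij Q_def by (auto simp: image_iff)
  qed
  have "N * card ?X \<le> K * card Q"
    using n(2) by (simp flip: of_nat_mult)
  also have "\<dots> \<le> K\<^sup>2 * K ^ 3"
    using Q(2) by (simp add: power2_eq_square power3_eq_cube mult_ac)
  also have "\<dots> \<le> N * K\<^sup>2"
    using small by (metis mult.commute mult_le_mono1)
  finally have X: "card ?X \<le> K\<^sup>2"
    using \<open>1 \<le> N\<close> by simp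
  have "card ?Y \<le> card ((\<lambda>r. (r, r)) ` P \<union> (\<lambda>r. (r, prod.swap r)) ` P \<union> ?X)"
    using sub P Q by (intro card_mono) auto
  also have "\<dots> \<le> card ((\<lambda>r. (r, r)) ` P \<union> (\<lambda>r. (r, prod.swap r)) ` P) + card ?X" by (rule card_Un_le)
  also have "\<dots> \<le> card ((\<lambda>r. (r, r)) ` P) + card ((\<lambda>r. (r, prod.swap r)) ` P) + card ?X"
    by (simp add: card_Un_le)
  also have "\<dots> \<le> K\<^sup>2 + K\<^sup>2 + K\<^sup>2"
    using X P card_image_le[of P "\<lambda>r. (r, r)"] card_image_le[of P "\<lambda>r. (r, prod.swap r)"] by simp
  finally show ?thesis using n(1) unfolding P_def by (intro bexI[of _ n]) auto
qed

text \<open>Pairs with different offsets give nondegenerate relations of total weight at most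
  \<open>(D * W)^2\<close>, and averaging over windows of length \<open>D\<close> yields the term
  \<open>D^3 * W^2\<close>. For equal offsets the factorial cancels, forcing \<open>a = a'\<close>;
  this diagonal has weight at most \<open>L * D * W\<close>.\<close>

lemma exists_window_small_weighted_multiplicative_energy:
  fixes p N D :: nat and w :: "int \<Rightarrow> real" and L :: real
  assumes "prime p" "N + D < p" "1 \<le> N"
    and w: "\<And>a. 0 \<le> w a" "\<And>a. w a \<le> L"
  defines "P \<equiv> {1..<int p} \<times> {1..D}"
  defines "W \<equiv> \<Sum>a\<in>{1..<int p}. w a"
  shows "\<exists>n\<in>{1..N}. real N * (\<Sum>q | q \<in> P \<times> P \<and>
            int p dvd fst (fst q) * fact (n + snd (fst q)) - fst (snd q) * fact (n + snd (snd q)).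
            w (fst (fst q)) * w (fst (snd q)))
          \<le> real N * real D * L * W + real D ^ 3 * W\<^sup>2"
proof -
  define Q where "Q = {q \<in> P \<times> P. snd (fst q) \<noteq> snd (snd q)}"
  define v where "v = (\<lambda>q :: (int \<times> nat) \<times> (int \<times> nat). w (fst (fst q)) * w (fst (snd q)))"
  define c where "c = (\<lambda>(q :: (int \<times> nat) \<times> (int \<times> nat)) h.
    (if h = snd (fst q) then fst (fst q) else 0) - (if h = snd (snd q) then fst (snd q) else 0))"
  have P: "finite P" by (simp add: P_def)
  then have Q: "finite Q" by (simp add: Q_def)
  have v: "0 \<le> v q" for q using w by (simp add: v_def)
  have sumP: "(\<Sum>x\<in>P. w (fst x)) = real D * W"
    unfolding P_def W_def by (simp add: sum.cartesian_product' sum_distrib_left)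
  have "(\<Sum>q\<in>Q. v q) \<le> (\<Sum>q\<in>P \<times> P. v q)"
    using P v by (intro sum_mono2) (auto simp: Q_def)
  also have "\<dots> = (\<Sum>x\<in>P. w (fst x)) * (\<Sum>x\<in>P. w (fst x))"
    by (simp add: v_def sum_product sum.cartesian_product case_prod_unfold)
  finally have sumQ: "(\<Sum>q\<in>Q. v q) \<le> (real D * W)\<^sup>2"
    unfolding sumP by (simp add: power2_eq_square)
  have nondeg: "\<exists>h\<in>{1..D}. \<not> int p dvd c q h" if "q \<in> Q" for q
  proof -
    have q: "snd (fst q) \<in> {1..D}" "fst (fst q) \<in> {1..<int p}" "snd (fst q) \<noteq> snd (snd q)"
      using that by (auto simp: Q_def P_def)
    then show ?thesis
      by (intro bexI[of _ "snd (fst q)"]) (auto simp: c_def dest: zdvd_imp_le)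
  qed
  obtain n where n: "n \<in> {1..N}"
    "real N * (\<Sum>q | q \<in> Q \<and> int p dvd (\<Sum>h=1..D. c q h * fact (n + h)). v q)
      \<le> real D * (\<Sum>q\<in>Q. v q)"
    using exists_base_point[of p N Q v D c] assms Q v nondeg by auto
  let ?X = "{q \<in> Q. int p dvd (\<Sum>h=1..D. c q h * fact (n + h))}"
  let ?Y = "{q \<in> P \<times> P. int p dvd fst (fst q) * fact (n + snd (fst q)) - fst (snd q) * fact (n + snd (snd q))}"
  have sub: "?Y \<subseteq> (\<lambda>x. (x, x)) ` P \<union> ?X"
  proof
    fix q assume q: "q \<in> ?Y"
    obtain a i a' j where ij: "q = ((a, i), (a', j))" by (metis surj_pair)
    have mem: "i \<in> {1..D}" "j \<in> {1..D}" "a \<in> {1..<int p}" "a' \<in> {1..<int p}"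
      using q unfolding ij P_def by auto
    have dvd: "int p dvd a * fact (n + i) - a' * fact (n + j)" using q unfolding ij by simp
    show "q \<in> (\<lambda>x. (x, x)) ` P \<union> ?X"
    proof (cases "i = j")
      case True
      then have "int p dvd (a - a') * fact (n + i)" using dvd by (simp add: left_diff_distrib)
      moreover have "\<not> int p dvd fact (n + i)"
      proof -
        have "n + i < p" using n(1) mem assms by auto
        then show ?thesis
          using \<open>prime p\<close> by (metis int_dvd_int_iff not_less of_nat_fact prime_dvd_fact_iff)
      qed
      ultimately have "int p dvd a - a'" using \<open>prime p\<close> by (simp add: prime_dvd_mult_iff)
      then have "a mod int p = a' mod int p" by (simp add: mod_eq_dvd_iff)
      then have "a = a'" using mem by simp
      then show ?thesis using True q ij by auto
    next
      case False
      have "(\<Sum>h=1..D. c q h * fact (n + h)) = a * fact (n + i) - a' * fact (n + j)"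
        using mem by (simp add: ij c_def left_diff_distrib sum_subtractf sum_if_eq_mult)
      then show ?thesis using False q dvd unfolding ij by (auto simp: Q_def)
    qed
  qed
  have "(\<Sum>q\<in>(\<lambda>x. (x, x)) ` P. v q) = (\<Sum>x\<in>P. w (fst x) * w (fst x))"
    by (subst sum.reindex) (auto simp: inj_on_def v_def)
  also have "\<dots> \<le> (\<Sum>x\<in>P. L * w (fst x))"
    using w by (intro sum_mono mult_right_mono) auto
  also have "\<dots> = L * (real D * W)" by (simp only: sum_distrib_left[symmetric] sumP)
  finally have diag: "(\<Sum>q\<in>(\<lambda>x. (x, x)) ` P. v q) \<le> L * (real D * W)" .
  have "(\<Sum>q\<in>?Y. v q) \<le> (\<Sum>q\<in>(\<lambda>x. (x, x)) ` P \<union> ?X. v q)"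
    using sub P Q v by (intro sum_mono2) auto
  also have "\<dots> \<le> (\<Sum>q\<in>(\<lambda>x. (x, x)) ` P. v q) + (\<Sum>q\<in>?X. v q)"
    using P Q v by (subst sum_Un) (auto intro!: sum_nonneg)
  also have "\<dots> \<le> L * (real D * W) + (\<Sum>q\<in>?X. v q)" using diag by simp
  finally have "real N * (\<Sum>q\<in>?Y. v q) \<le> real N * (L * (real D * W) + (\<Sum>q\<in>?X. v q))"
    by (intro mult_left_mono) auto
  also have "real N * (L * (real D * W) + (\<Sum>q\<in>?X. v q))
      \<le> real N * (L * (real D * W)) + real D * (real D * W)\<^sup>2"
    using n(2) mult_left_mono[OF sumQ, of "real D"] by (simp add: distrib_left)
  finally have "real N * (\<Sum>q\<in>?Y. v q) \<le> real N * real D * L * W + real D ^ 3 * W\<^sup>2"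
    by (simp add: algebra_simps power2_eq_square power3_eq_cube)
  then show ?thesis using n(1) unfolding v_def by blast
qed

section \<open>From exponential sums to represented residues\<close>

text \<open>Orthogonality writes \<open>p\<close> times the number of solutions as a character sum
  whose term at \<open>a = 0\<close> is \<open>card J\<close>; without solutions the remaining terms
  would have to cancel it.\<close>

lemma exists_solution_if_norm_exp_sum_less:
  fixes p :: nat and l :: int
  assumes "p > 0" "finite J"
    and less: "(\<Sum>a\<in>{1..<int p}. cmod (exp_sum p J g a)) < real (card J)"
  shows "\<exists>j\<in>J. int p dvd g j - l"
proof (rule ccontr)
  assume none: "\<not> ?thesis"
  have eq: "exp_sum p J g a * add_char p (- (a * l)) = (\<Sum>j\<in>J. add_char p (a * (g j - l)))" for a
    by (simp add: exp_sum_def sum_distrib_right right_diff_distrib flip: add_char_add)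
  have "(\<Sum>a\<in>{0..<int p}. exp_sum p J g a * add_char p (- (a * l)))
      = (\<Sum>j\<in>J. \<Sum>a\<in>{0..<int p}. add_char p (a * (g j - l)))"
    unfolding eq by (rule sum.swap)
  also have "\<dots> = 0" using none assms by (simp add: sum_add_char)
  finally have "(\<Sum>a\<in>{0..<int p}. exp_sum p J g a * add_char p (- (a * l))) = 0" .
  moreover have "{0..<int p} = insert 0 {1..<int p}" using assms by auto
  ultimately have "of_nat (card J) = - (\<Sum>a\<in>{1..<int p}. exp_sum p J g a * add_char p (- (a * l)))"
    by (simp add: eq_neg_iff_add_eq_0)
  then have "real (card J) = cmod (\<Sum>a\<in>{1..<int p}. exp_sum p J g a * add_char p (- (a * l)))"
    by (metis norm_minus_cancel norm_of_nat)
  also have "\<dots> \<le> (\<Sum>a\<in>{1..<int p}. cmod (exp_sum p J g a))"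
    by (rule order_trans[OF norm_sum]) (simp add: norm_mult)
  finally show False using less by simp
qed

text \<open>Squaring a fibre sum gives pairs in a common fibre. With \<open>key\<close> the residue
  of \<open>a * m!\<close>, the right-hand side becomes the weighted multiplicative energy.\<close>

lemma sum_square_fibers:
  fixes w :: "'a \<Rightarrow> real"
  assumes "finite P" "finite T" "\<And>x. x \<in> P \<Longrightarrow> key x \<in> T"
  shows "(\<Sum>b\<in>T. (\<Sum>x | x \<in> P \<and> key x = b. w x)\<^sup>2)
       = (\<Sum>q | q \<in> P \<times> P \<and> key (fst q) = key (snd q). w (fst q) * w (snd q))"
proof -
  let ?Y = "{q \<in> P \<times> P. key (fst q) = key (snd q)}"
  have "(\<Sum>q\<in>?Y. w (fst q) * w (snd q))
      = (\<Sum>b\<in>T. \<Sum>q | q \<in> ?Y \<and> key (fst q) = b. w (fst q) * w (snd q))"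
    using assms by (intro sum.group[symmetric]) auto
  also have "\<dots> = (\<Sum>b\<in>T. (\<Sum>x | x \<in> P \<and> key x = b. w x)\<^sup>2)"
  proof (rule sum.cong)
    fix b
    have "{q \<in> ?Y. key (fst q) = b} = {x \<in> P. key x = b} \<times> {x \<in> P. key x = b}" by auto
    then show "(\<Sum>q | q \<in> ?Y \<and> key (fst q) = b. w (fst q) * w (snd q))
        = (\<Sum>x | x \<in> P \<and> key x = b. w x)\<^sup>2"
      by (simp add: power2_eq_square sum_product sum.cartesian_product case_prod_unfold)
  qed simp
  finally show ?thesis by simp
qed

text \<open>With \<open>C = H choose k\<close>, the term at \<open>a = 0\<close> is
  \<open>D * K * C^2\<close>. Comparing its fourth power, times \<open>N\<close>, with the bound for
  the other terms and dividing by \<open>D^3 * C^4 * K^2\<close> gives exactly the inequality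
  \<open>less\<close>.\<close>

lemma factorial_sums_represent_residue:
  fixes p N H K D k :: nat and l :: int
  assumes "prime p" "2 < p" "1 \<le> N" "N + D < p"
    and H: "(H choose k) * H \<le> N" and K: "K ^ 3 \<le> N"
    and less: "24 * real p ^ 4 * real N * real (H choose k) + 48 * real p ^ 5 * (real D)\<^sup>2
      < real N * real D * (real K)\<^sup>2 * real (H choose k) ^ 4"
  shows "\<exists>m n A A'. m \<in> {1..N + D} \<and> n \<in> {1..N + K} \<and> A \<subseteq> {1..N + H} \<and> A' \<subseteq> {1..N + H}
    \<and> card A = k \<and> card A' = k
    \<and> [fact m * fact n + ((\<Sum>h\<in>A. fact h) + (\<Sum>h\<in>A'. fact h)) = l] (mod int p)"
proof -
  have "p > 0" "N < p" using assms by auto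
  define C where "C = H choose k"
  define U where "U = {1..<int p}"
  define I where "I = {A. A \<subseteq> {1..H} \<and> card A = k}"
  have I: "finite I" "card I = C"
    unfolding I_def C_def using n_subsets[of "{1..H}" k] by auto
  obtain n0 where n0: "n0 \<in> {1..N}" "card {(A, A'). A \<in> I \<and> A' \<in> I \<and>
      int p dvd (\<Sum>h\<in>A. fact (n0 + h)) - (\<Sum>h\<in>A'. fact (n0 + h))} \<le> 2 * C"
    using exists_window_few_subset_sum_collisions[OF \<open>prime p\<close> \<open>N < p\<close> \<open>1 \<le> N\<close> H]
    unfolding I_def C_def by blast
  define f where "f = (\<lambda>A. \<Sum>h\<in>A. fact (n0 + h) :: int)"
  define F where "F = (\<lambda>a. cmod (exp_sum p I f a))"
  define w where "w = (\<lambda>a. (F a)\<^sup>2)"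
  define W where "W = (\<Sum>a\<in>U. w a)"
  have w: "0 \<le> w a" "w a \<le> (real C)\<^sup>2" for a
    using norm_exp_sum_le[of p I f a] I by (auto simp: w_def F_def intro: power_mono)
  have W: "0 \<le> W" "W \<le> 2 * real p * real C"
  proof -
    show "0 \<le> W" using w by (simp add: W_def sum_nonneg)
    \<comment> \<open>Including \<open>a = 0\<close> makes Parseval applicable; the first window has
      at most \<open>2 * C\<close> coincidences.\<close>
    have "W \<le> (\<Sum>a\<in>{0..<int p}. w a)"
      unfolding W_def U_def using w by (intro sum_mono2) auto
    also have "\<dots> = real p * real (card {(A, A'). A \<in> I \<and> A' \<in> I \<and> int p dvd f A - f A'})"
      unfolding w_def F_def using \<open>p > 0\<close> I by (intro sum_norm_exp_sum_sq)
    also have "\<dots> \<le> real p * real (2 * C)"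
      using n0(2) unfolding f_def by (intro mult_left_mono) auto
    finally show "W \<le> 2 * real p * real C" by simp
  qed
  obtain n1 where n1: "n1 \<in> {1..N}"
    "card {(r, s). r \<in> {1..K} \<times> {1..K} \<and> s \<in> {1..K} \<times> {1..K} \<and>
            int p dvd (\<lambda>(i, j). fact (n1 + i) + fact (n1 + j)) r
              - (\<lambda>(i, j). fact (n1 + i) + fact (n1 + j)) s} \<le> 3 * K\<^sup>2"
    using exists_window_small_energy[OF \<open>prime p\<close> \<open>2 < p\<close> \<open>N < p\<close> \<open>1 \<le> N\<close> K] by blast
  define y where "y = (\<lambda>h. fact (n1 + h) :: int)"
  define Y where "Y = (\<lambda>b. cmod (exp_sum p {1..K} y b))"
  have Y4: "(\<Sum>b\<in>{0..<int p}. Y b ^ 4) \<le> real p * (3 * (real K)\<^sup>2)"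
  proof -
    have "Y b ^ 4 = (cmod (exp_sum p ({1..K} \<times> {1..K}) (\<lambda>(i, j). y i + y j) b))\<^sup>2" for b
      unfolding Y_def exp_sum_mult[symmetric] by (simp add: norm_mult power2_eq_square power4_eq_xxxx)
    then have "(\<Sum>b\<in>{0..<int p}. Y b ^ 4)
        = real p * real (card {(r, s). r \<in> {1..K} \<times> {1..K} \<and> s \<in> {1..K} \<times> {1..K} \<and>
            int p dvd (\<lambda>(i, j). y i + y j) r - (\<lambda>(i, j). y i + y j) s})"
      using \<open>p > 0\<close> by (simp only:) (intro sum_norm_exp_sum_sq, auto)
    also have "\<dots> \<le> real p * real (3 * K\<^sup>2)"
      using n1(2) unfolding y_def by (intro mult_left_mono of_nat_mono) auto
    finally show ?thesis by simp
  qed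
  define P where "P = U \<times> {1..D}"
  have "\<exists>n\<in>{1..N}. real N * (\<Sum>q | q \<in> P \<times> P \<and>
       int p dvd fst (fst q) * fact (n + snd (fst q)) - fst (snd q) * fact (n + snd (snd q)).
       w (fst (fst q)) * w (fst (snd q)))
     \<le> real N * real D * (real C)\<^sup>2 * W + real D ^ 3 * W\<^sup>2"
    unfolding P_def W_def U_def
    by (rule exists_window_small_weighted_multiplicative_energy[OF \<open>prime p\<close> \<open>N + D < p\<close> \<open>1 \<le> N\<close> w])
  then obtain n2 where n2: "n2 \<in> {1..N}"
    "real N * (\<Sum>q | q \<in> P \<times> P \<and>
       int p dvd fst (fst q) * fact (n2 + snd (fst q)) - fst (snd q) * fact (n2 + snd (snd q)).
       w (fst (fst q)) * w (fst (snd q)))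
     \<le> real N * real D * (real C)\<^sup>2 * W + real D ^ 3 * W\<^sup>2"
    by (rule bexE)
  define key where "key = (\<lambda>x. (fst x * fact (n2 + snd x)) mod int p)"
  define E where "E = (\<Sum>q | q \<in> P \<times> P \<and> key (fst q) = key (snd q). w (fst (fst q)) * w (fst (snd q)))"
  have E: "real N * E \<le> real N * real D * (real C)\<^sup>2 * W + real D ^ 3 * W\<^sup>2"
    using n2(2) unfolding E_def key_def mod_eq_dvd_iff .
  have P: "finite P" by (simp add: P_def U_def)
  have key: "key x \<in> {0..<int p}" for x using \<open>p > 0\<close> by (simp add: key_def)
  have sumP: "(\<Sum>x\<in>P. w (fst x)) = real D * W"
    unfolding P_def W_def by (simp add: sum.cartesian_product' sum_distrib_left)
  define G where "G = (\<Sum>x\<in>P. w (fst x) * Y (key x))"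
  define V where "V = (\<Sum>x\<in>P. w (fst x) * (Y (key x))\<^sup>2)"
  \<comment> \<open>Cauchy-Schwarz over \<open>P\<close>, with \<open>w * Y\<close> split as
    \<open>F * (F * Y)\<close>, leaves \<open>Y\<^sup>2\<close> weighted by
    \<open>w\<close>.\<close>
  have "G = (\<Sum>x\<in>P. F (fst x) * (F (fst x) * Y (key x)))"
    by (simp add: G_def w_def power2_eq_square mult_ac)
  also have "\<dots>\<^sup>2 \<le> (\<Sum>x\<in>P. (F (fst x))\<^sup>2) * (\<Sum>x\<in>P. (F (fst x) * Y (key x))\<^sup>2)"
    by (rule Cauchy_Schwarz_ineq_sum)
  finally have G2: "G\<^sup>2 \<le> real D * W * V"
    using sumP by (simp add: V_def w_def power_mult_distrib)
  \<comment> \<open>Grouping by the residue \<open>b\<close> of \<open>a * m!\<close> and applying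
    Cauchy-Schwarz again separates the weighted energy \<open>E\<close> from the fourth moment of
    \<open>Y\<close>.\<close>
  have "V = (\<Sum>b\<in>{0..<int p}. \<Sum>x | x \<in> P \<and> key x = b. w (fst x) * (Y (key x))\<^sup>2)"
    unfolding V_def using P key by (intro sum.group[symmetric]) auto
  also have "\<dots> = (\<Sum>b\<in>{0..<int p}. (\<Sum>x | x \<in> P \<and> key x = b. w (fst x)) * (Y b)\<^sup>2)"
    by (simp add: sum_distrib_right)
  also have "\<dots>\<^sup>2 \<le> (\<Sum>b\<in>{0..<int p}. (\<Sum>x | x \<in> P \<and> key x = b. w (fst x))\<^sup>2)
      * (\<Sum>b\<in>{0..<int p}. ((Y b)\<^sup>2)\<^sup>2)"
    by (rule Cauchy_Schwarz_ineq_sum)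
  also have "\<dots> = E * (\<Sum>b\<in>{0..<int p}. Y b ^ 4)"
    using sum_square_fibers[OF P, of "{0..<int p}" key "\<lambda>x. w (fst x)"] key
    by (simp add: E_def flip: power_mult)
  also have "\<dots> \<le> E * (real p * (3 * (real K)\<^sup>2))"
    using Y4 w unfolding E_def by (intro mult_left_mono sum_nonneg) auto
  finally have V2: "V\<^sup>2 \<le> E * (real p * (3 * (real K)\<^sup>2))" .
  \<comment> \<open>The right-hand side is the cardinality of the parameter set \<open>J\<close>
    below. Fourth powers avoid square roots, and the extra factor \<open>N\<close> lets the bound
    for \<open>N * E\<close> enter.\<close>
  have GD: "G < real D * real K * (real C)\<^sup>2"
  proof (rule ccontr)
    assume "\<not> ?thesis"
    then have ge: "real D * real K * (real C)\<^sup>2 \<le> G" by simp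
    have "0 \<le> V" "0 \<le> G" unfolding V_def G_def Y_def using w by (auto intro!: sum_nonneg)
    have "(real D * real K * (real C)\<^sup>2) ^ 4 * real N \<le> G ^ 4 * real N"
      using ge by (intro mult_right_mono power_mono) auto
    also have "G ^ 4 = (G\<^sup>2)\<^sup>2" by simp
    also have "(G\<^sup>2)\<^sup>2 * real N \<le> (real D * W * V)\<^sup>2 * real N"
      using G2 by (intro mult_right_mono power_mono) auto
    also have "\<dots> = (real D * W)\<^sup>2 * V\<^sup>2 * real N" by (simp add: power_mult_distrib)
    also have "\<dots> \<le> (real D * W)\<^sup>2 * (E * (real p * (3 * (real K)\<^sup>2))) * real N"
      using V2 by (intro mult_right_mono mult_left_mono) auto
    also have "\<dots> = (real D * W)\<^sup>2 * (real p * (3 * (real K)\<^sup>2)) * (real N * E)" by (simp add: mult_ac)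
    also have "\<dots> \<le> (real D * W)\<^sup>2 * (real p * (3 * (real K)\<^sup>2))
        * (real N * real D * (real C)\<^sup>2 * W + real D ^ 3 * W\<^sup>2)"
      using E by (intro mult_left_mono) auto
    also have "\<dots> \<le> (real D * (2 * real p * real C))\<^sup>2 * (real p * (3 * (real K)\<^sup>2))
        * (real N * real D * (real C)\<^sup>2 * (2 * real p * real C) + real D ^ 3 * (2 * real p * real C)\<^sup>2)"
      using W by (intro mult_mono power_mono add_mono mult_nonneg_nonneg add_nonneg_nonneg) auto
    also have "\<dots> = (real D ^ 3 * real C ^ 4 * (real K)\<^sup>2)
        * (24 * real p ^ 4 * real N * real C + 48 * real p ^ 5 * (real D)\<^sup>2)"
      by algebra
    also have "(real D * real K * (real C)\<^sup>2) ^ 4 * real N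
        = (real D ^ 3 * real C ^ 4 * (real K)\<^sup>2) * (real N * real D * (real K)\<^sup>2 * real C ^ 4)"
      by algebra
    finally have "(real D ^ 3 * real C ^ 4 * (real K)\<^sup>2) * (real N * real D * (real K)\<^sup>2 * real C ^ 4)
        \<le> (real D ^ 3 * real C ^ 4 * (real K)\<^sup>2)
        * (24 * real p ^ 4 * real N * real C + 48 * real p ^ 5 * (real D)\<^sup>2)" .
    moreover have "real D ^ 3 * real C ^ 4 * (real K)\<^sup>2 > 0"
    proof -
      have "0 < real N * real D * (real K)\<^sup>2 * real C ^ 4"
        using less unfolding C_def by (rule le_less_trans[rotated]) simp
      then have "D \<noteq> 0" "K \<noteq> 0" "C \<noteq> 0" by (auto intro!: Nat.gr0I)
      then show ?thesis by simp
    qed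
    ultimately show False using less unfolding C_def by (simp add: mult_le_cancel_left_pos)
  qed
  define J where "J = ({1..D} \<times> {1..K}) \<times> (I \<times> I)"
  define g where "g = (\<lambda>((i, h), (A, A')). fact (n2 + i) * y h + (f A + f A'))"
  \<comment> \<open>The two sums over subsets factor out and contribute \<open>w a\<close> in
    modulus; for fixed \<open>i\<close> the sum over \<open>h\<close> is the second window's
    exponential sum at the residue of \<open>a * (n2 + i)!\<close>. The triangle inequality is
    applied only to the sum over \<open>i\<close>.\<close>
  have norm_J: "cmod (exp_sum p J g a) \<le> (\<Sum>i=1..D. w a * Y (key (a, i)))" for a
  proof -
    have "exp_sum p J g a = exp_sum p ({1..D} \<times> {1..K}) (\<lambda>(i, h). fact (n2 + i) * y h) a
        * (exp_sum p I f a * exp_sum p I f a)"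
      unfolding J_def g_def exp_sum_mult by (simp add: case_prod_unfold)
    also have "exp_sum p ({1..D} \<times> {1..K}) (\<lambda>(i, h). fact (n2 + i) * y h) a
        = (\<Sum>i=1..D. exp_sum p {1..K} y (key (a, i)))"
      unfolding key_def using \<open>p > 0\<close>
      by (simp add: exp_sum_mod) (simp add: exp_sum_def sum.cartesian_product case_prod_unfold mult_ac)
    finally have "cmod (exp_sum p J g a) = cmod (\<Sum>i=1..D. exp_sum p {1..K} y (key (a, i))) * w a"
      by (simp add: norm_mult w_def F_def power2_eq_square)
    also have "\<dots> \<le> (\<Sum>i=1..D. Y (key (a, i))) * w a"
      using w unfolding Y_def by (intro mult_right_mono norm_sum) auto
    finally show ?thesis by (simp add: sum_distrib_left mult_ac)
  qed
  have "(\<Sum>a\<in>{1..<int p}. cmod (exp_sum p J g a)) \<le> (\<Sum>a\<in>{1..<int p}. \<Sum>i=1..D. w a * Y (key (a, i)))"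
    by (intro sum_mono norm_J)
  also have "\<dots> = G"
    unfolding G_def P_def U_def by (simp add: sum.cartesian_product case_prod_unfold)
  also have "\<dots> < real (card J)"
    using GD I by (simp add: J_def card_cartesian_product power2_eq_square mult_ac)
  finally have "\<exists>j\<in>J. int p dvd g j - l"
    using \<open>p > 0\<close> I by (intro exists_solution_if_norm_exp_sum_less) (auto simp: J_def)
  then obtain i h A A' where sol: "i \<in> {1..D}" "h \<in> {1..K}" "A \<in> I" "A' \<in> I"
    "int p dvd fact (n2 + i) * y h + (f A + f A') - l"
    unfolding J_def g_def by fastforce
  \<comment> \<open>Members of \<open>I\<close> are sets of offsets; translation by
    \<open>n0\<close> gives the actual arguments of the factorials.\<close>
  have shift: "(+) n0 ` B \<subseteq> {1..N + H} \<and> card ((+) n0 ` B) = k \<and> (\<Sum>h\<in>(+) n0 ` B. fact h) = f B"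
    if "B \<in> I" for B
    using that n0(1) by (auto simp: I_def f_def card_image sum.reindex)
  have "[fact (n2 + i) * fact (n1 + h)
      + ((\<Sum>h\<in>(+) n0 ` A. fact h) + (\<Sum>h\<in>(+) n0 ` A'. fact h)) = l] (mod int p)"
    using sol shift[of A] shift[of A'] by (simp add: y_def cong_iff_dvd_diff)
  moreover have "n2 + i \<in> {1..N + D}" "n1 + h \<in> {1..N + K}" using n2(1) n1(1) sol by auto
  ultimately show ?thesis
    using shift[OF sol(3)] shift[OF sol(4)]
    by (intro exI[of _ "n2 + i"] exI[of _ "n1 + h"] exI[of _ "(+) n0 ` A"] exI[of _ "(+) n0 ` A'"]) simp
qed

section \<open>Choice of the window sizes\<close>

lemma half_le_nat_floor:
  fixes t :: real
  assumes "2 \<le> t"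
  shows "t / 2 \<le> real (nat \<lfloor>t\<rfloor>)" "real (nat \<lfloor>t\<rfloor>) \<le> t"
  using assms by linarith+

lemma powr_power_real: "0 < x \<Longrightarrow> (x powr a) ^ n = (x :: real) powr (real n * a)"
  by (simp add: powr_def exp_of_nat_mult [symmetric] mult_ac)

text \<open>The exponents \<open>0.0416\<close> and \<open>0.333\<close> lie just below \<open>1/24\<close> and \<open>1/3\<close> times \<open>1300/1301\<close>, the limits
  imposed by the first two windows; \<open>0.478\<close> balances the two terms on the left of the last inequality,
  which then holds with \<open>p\<^bsup>0.0144\<^esup>\<close> to spare.\<close>

lemma window_sizes_admissible:
  fixes p :: nat
  defines "x \<equiv> real p"
  assumes large: "2 < x" "46 \<le> x powr (26 / 625)" "2 * x powr (1300 / 1301) < x"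
    "768 * 46 ^ 92 < x powr (9 / 625)"
  defines "N \<equiv> nat \<lfloor>x powr (1300 / 1301)\<rfloor>"
    and "H \<equiv> nat \<lfloor>x powr (26 / 625)\<rfloor>"
    and "K \<equiv> nat \<lfloor>x powr (333 / 1000)\<rfloor>"
    and "D \<equiv> nat \<lfloor>x powr (239 / 500)\<rfloor>"
  shows "1 \<le> N" "real (N + H) \<le> 2 * x powr (1300 / 1301)" "real (N + K) \<le> 2 * x powr (1300 / 1301)"
    "real (N + D) \<le> 2 * x powr (1300 / 1301)"
    "N + D < p" "(H choose 23) * H \<le> N" "K ^ 3 \<le> N"
    "24 * x ^ 4 * real N * real (H choose 23) + 48 * x ^ 5 * (real D)\<^sup>2
      < real N * real D * (real K)\<^sup>2 * real (H choose 23) ^ 4"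
proof -
  have x: "0 < x" "1 \<le> x" using large by auto
  \<comment> \<open>Rounding down costs at most a factor \<open>2\<close>, so the bound
    \<open>46 = 2 * 23\<close> guarantees \<open>23 \<le> H\<close>; it also makes
    \<open>half_le_nat_floor\<close> applicable to every window size.\<close>
  have ge46: "46 \<le> x powr a" if "26 / 625 \<le> a" for a
    using large(2) powr_mono[OF that \<open>1 \<le> x\<close>] by linarith
  have N: "x powr (1300 / 1301) / 2 \<le> real N" "real N \<le> x powr (1300 / 1301)"
    unfolding N_def using ge46[of "1300 / 1301"] by (intro half_le_nat_floor; simp)+
  have H: "x powr (26 / 625) / 2 \<le> real H" "real H \<le> x powr (26 / 625)"
    unfolding H_def using ge46[of "26 / 625"] by (intro half_le_nat_floor; simp)+
  have K: "x powr (333 / 1000) / 2 \<le> real K" "real K \<le> x powr (333 / 1000)"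
    unfolding K_def using ge46[of "333 / 1000"] by (intro half_le_nat_floor; simp)+
  have D: "x powr (239 / 500) / 2 \<le> real D" "real D \<le> x powr (239 / 500)"
    unfolding D_def using ge46[of "239 / 500"] by (intro half_le_nat_floor; simp)+
  have pos: "0 < real N" "0 < real D" "0 < real K"
    using N D K ge46[of "1300 / 1301"] ge46[of "333 / 1000"] ge46[of "239 / 500"] by auto
  show "1 \<le> N" using pos by simp
  have mono: "x powr a \<le> x powr (1300 / 1301)" if "a \<le> 1300 / 1301" for a
    using that x by (intro powr_mono) auto
  show "real (N + H) \<le> 2 * x powr (1300 / 1301)" using N H mono[of "26 / 625"] by simp
  show "real (N + K) \<le> 2 * x powr (1300 / 1301)" using N K mono[of "333 / 1000"] by simp
  show ND: "real (N + D) \<le> 2 * x powr (1300 / 1301)" using N D mono[of "239 / 500"] by simp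
  have "real (N + D) < real p" using ND large(3) unfolding x_def by (rule le_less_trans)
  then show "N + D < p" by simp
  have H23: "23 \<le> H" using H ge46[of "26 / 625"] by simp
  have "(H choose 23) * H \<le> H ^ 23 * H"
    using H23 by (intro mult_right_mono binomial_le_pow) auto
  also have "\<dots> = H ^ 24" by (simp flip: power_Suc2)
  also have "real (H ^ 24) \<le> (x powr (26 / 625)) ^ 24"
    using H by (simp add: power_mono)
  then have "real (H ^ 24) \<le> x powr (1300 / 1301)"
    using x mono[of "24 * (26 / 625)"] by (simp add: powr_power_real)
  then have "H ^ 24 \<le> N" unfolding N_def by (rule le_nat_floor)
  finally show "(H choose 23) * H \<le> N" .
  have "real (K ^ 3) \<le> (x powr (333 / 1000)) ^ 3"
    using K by (simp add: power_mono)
  then have "real (K ^ 3) \<le> x powr (1300 / 1301)"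
    using x mono[of "3 * (333 / 1000)"] by (simp add: powr_power_real)
  then show "K ^ 3 \<le> N" unfolding N_def by (rule le_nat_floor)
  define C where "C = real (H choose 23)"
  \<comment> \<open>This constant comes from \<open>H choose 23 \<ge> (H / 23)^23\<close> and
    \<open>H \<ge> x powr (26 / 625) / 2\<close>; the matching exponent is
    \<open>598 / 625 = 23 * 26 / 625\<close>.\<close>
  define \<kappa> :: real where "\<kappa> = (1 / 46) ^ 23"
  have \<kappa>: "0 < \<kappa>" "\<kappa> \<le> 1" by (simp_all add: \<kappa>_def power_le_one)
  have "\<kappa> * x powr (598 / 625) = (x powr (26 / 625) / 46) ^ 23"
    using x by (simp add: \<kappa>_def power_divide powr_power_real)
  also have "\<dots> \<le> (real H / 23) ^ 23"
    using H by (intro power_mono) auto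
  also have "\<dots> \<le> C"
    unfolding C_def using binomial_ge_n_over_k_pow_k[OF H23, where 'a = real] by simp
  finally have C: "\<kappa> * x powr (598 / 625) \<le> C" .
  then have C0: "0 < C" using \<kappa> x by (smt (verit) mult_pos_pos powr_gt_zero)
  \<comment> \<open>Here \<open>768 = 96 * 8\<close>: the coefficient \<open>96\<close> occurs in
    \<open>B\<close>, and \<open>8\<close> pays for rounding three factors, \<open>K\<close> twice
    and \<open>D\<close> or \<open>N\<close> once; \<open>46^92\<close> is
    \<open>1 / \<kappa>^4\<close>.\<close>
  have M: "768 < \<kappa> ^ 4 * x powr (9 / 625)"
    using large(4) by (simp add: \<kappa>_def power_divide field_simps flip: power_mult)
  have "\<kappa> ^ 4 \<le> \<kappa> ^ 3" using \<kappa> by (intro power_decreasing) auto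
  then have M': "768 < \<kappa> ^ 3 * x powr (9 / 625)"
    using M mult_right_mono[of "\<kappa> ^ 4" "\<kappa> ^ 3" "x powr (9 / 625)"] by simp
  \<comment> \<open>Multiplied by \<open>N * C\<close>, the inequality \<open>A\<close> puts the
    first term on the left of the goal below half of the right-hand side; \<open>B\<close>,
    multiplied by \<open>D\<close>, does so for the second term.\<close>
  have A: "48 * x ^ 4 < real D * (real K)\<^sup>2 * C ^ 3"
  proof -
    have "48 * x ^ 4 < \<kappa> ^ 3 * x powr (9 / 625) / 8 * x ^ 4"
      using M' x by (intro mult_strict_right_mono) auto
    also have "\<dots> = x powr (239 / 500) / 2 * (x powr (333 / 1000) / 2)\<^sup>2 * (\<kappa> * x powr (598 / 625)) ^ 3"
    proof -
      have "x powr (9 / 625) * x ^ 4 = x powr (2509 / 625)"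
        using x powr_add[of x "9 / 625" 4] by simp
      also have "\<dots> = x powr (239 / 500) * (x powr (333 / 1000))\<^sup>2 * (x powr (598 / 625)) ^ 3"
        using x by (simp add: powr_power_real flip: powr_add)
      finally show ?thesis by (simp add: power_mult_distrib power_divide mult_ac)
    qed
    also have "\<dots> \<le> real D * (real K)\<^sup>2 * C ^ 3"
      using D K C \<kappa> by (intro mult_mono power_mono) auto
    finally show ?thesis .
  qed
  have B: "96 * x ^ 5 * real D < real N * (real K)\<^sup>2 * C ^ 4"
  proof -
    have "96 * x ^ 5 * real D \<le> 96 * x ^ 5 * x powr (239 / 500)"
      using D x by (intro mult_left_mono) auto
    also have "\<dots> = 96 * (x ^ 5 * x powr (239 / 500))" by simp
    also have "\<dots> < \<kappa> ^ 4 * x powr (9 / 625) / 8 * (x ^ 5 * x powr (239 / 500))"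
      using M x by (intro mult_strict_right_mono) auto
    \<comment> \<open>The exponent \<open>1249 / 1250\<close>, just below
      \<open>1300 / 1301\<close>, makes the exponents on both sides agree exactly.\<close>
    also have "\<dots> = x powr (1249 / 1250) / 2 * (x powr (333 / 1000) / 2)\<^sup>2 * (\<kappa> * x powr (598 / 625)) ^ 4"
    proof -
      have "x powr (9 / 625) * (x ^ 5 * x powr (239 / 500)) = x powr (13731 / 2500)"
        using x powr_add[of x "9 / 625" "239 / 500"] powr_add[of x "1231 / 2500" 5] by simp
      also have "\<dots> = x powr (1249 / 1250) * (x powr (333 / 1000))\<^sup>2 * (x powr (598 / 625)) ^ 4"
        using x by (simp add: powr_power_real flip: powr_add)
      finally show ?thesis by (simp add: power_mult_distrib power_divide mult_ac)
    qed
    also have "\<dots> \<le> real N * (real K)\<^sup>2 * C ^ 4"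
      using N K C \<kappa> mono[of "1249 / 1250"] by (intro mult_mono power_mono) auto
    finally show ?thesis .
  qed
  have "48 * x ^ 4 * (real N * C) < real D * (real K)\<^sup>2 * C ^ 3 * (real N * C)"
    using A pos C0 by (intro mult_strict_right_mono) auto
  also have "\<dots> = real N * real D * (real K)\<^sup>2 * C ^ 4" by algebra
  finally have "48 * x ^ 4 * (real N * C) < real N * real D * (real K)\<^sup>2 * C ^ 4" .
  moreover have "96 * x ^ 5 * real D * real D < real N * (real K)\<^sup>2 * C ^ 4 * real D"
    using B pos by (intro mult_strict_right_mono) auto
  moreover have "48 * x ^ 4 * (real N * C) = 2 * (24 * x ^ 4 * real N * C)" by simp
  moreover have "96 * x ^ 5 * real D * real D = 2 * (48 * x ^ 5 * (real D)\<^sup>2)" by algebra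
  moreover have "real N * (real K)\<^sup>2 * C ^ 4 * real D = real N * real D * (real K)\<^sup>2 * C ^ 4" by algebra
  ultimately show "24 * x ^ 4 * real N * real (H choose 23) + 48 * x ^ 5 * (real D)\<^sup>2
      < real N * real D * (real K)\<^sup>2 * real (H choose 23) ^ 4"
    unfolding C_def by linarith
qed

section \<open>Assembling the 47 factorials\<close>

theorem theorem2:
  shows "\<exists>C::real. C > 0 \<and> (\<exists>p\<^sub>0::nat. \<forall>p::nat. prime p \<and> p \<ge> p\<^sub>0 \<longrightarrow>
    (\<forall>l::int. \<exists>(m::nat) (n::nat) (k::nat \<Rightarrow> nat).
      m > 0 \<and> n > 0 \<and> (\<forall>i\<in>{1..47}. k i > 0) \<and>
      real (Max ({m, n} \<union> k ` {1..47})) \<le> C * real p powr (1300 / 1301) \<and>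
      [fact m * fact n + (\<Sum>i=1..47. fact (k i)) = l] (mod int p)))"
proof -
  let ?M = "768 * 46 ^ 92 :: real"
  have "\<forall>\<^sub>F x :: real in at_top. 2 < x" by real_asymp
  moreover have "\<forall>\<^sub>F x :: real in at_top. 46 \<le> x powr (26 / 625)" by real_asymp
  moreover have "\<forall>\<^sub>F x :: real in at_top. 2 * x powr (1300 / 1301) < x" by real_asymp
  moreover have "\<forall>\<^sub>F x :: real in at_top. M < x powr (9 / 625)" for M :: real by real_asymp
  ultimately have "\<forall>\<^sub>F x :: real in at_top. 2 < x \<and> 46 \<le> x powr (26 / 625)
      \<and> 2 * x powr (1300 / 1301) < x \<and> ?M < x powr (9 / 625)"
    by (intro eventually_conj)
  then obtain x0 :: real where x0: "\<And>x. x \<ge> x0 \<Longrightarrow> 2 < x \<and> 46 \<le> x powr (26 / 625)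
      \<and> 2 * x powr (1300 / 1301) < x \<and> ?M < x powr (9 / 625)"
    unfolding eventually_at_top_linorder by blast
  have main: "\<exists>(m::nat) (n::nat) (k::nat \<Rightarrow> nat).
      m > 0 \<and> n > 0 \<and> (\<forall>i\<in>{1..47}. k i > 0) \<and>
      real (Max ({m, n} \<union> k ` {1..47})) \<le> 2 * real p powr (1300 / 1301) \<and>
      [fact m * fact n + (\<Sum>i=1..47. fact (k i)) = l] (mod int p)"
    if "prime p" and p0: "p \<ge> nat \<lceil>x0\<rceil>" for p :: nat and l :: int
  proof -
    \<comment> \<open>Every argument is a base point at most \<open>N\<close> plus an offset within
      its window, hence the constant \<open>2\<close>.\<close>
    define T where "T = 2 * real p powr (1300 / 1301)"
    have "real p \<ge> x0" using p0 by linarith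
    from x0[OF this] have large: "2 < real p" "46 \<le> real p powr (26 / 625)"
      "2 * real p powr (1300 / 1301) < real p" "?M < real p powr (9 / 625)" by auto
    note adm = window_sizes_admissible[OF large]
    have "2 < p" using large(1) by simp
    \<comment> \<open>The residue \<open>l - 1\<close> is represented, because the last summand adds
      \<open>1! = 1\<close>.\<close>
    obtain m n A A' where mn: "0 < m" "0 < n" "real m \<le> T" "real n \<le> T"
      and A: "card A = 23" "\<And>h. h \<in> A \<Longrightarrow> 0 < h \<and> real h \<le> T"
      and A': "card A' = 23" "\<And>h. h \<in> A' \<Longrightarrow> 0 < h \<and> real h \<le> T"
      and sol: "[fact m * fact n + ((\<Sum>h\<in>A. fact h) + (\<Sum>h\<in>A'. fact h)) = l - 1] (mod int p)"
    proof -
      have le: "0 < j \<and> real j \<le> T" if "j \<in> {1..B}" "real B \<le> T" for j B :: nat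
        using that by auto
      obtain m n A A' where *: "m \<in> {1..nat \<lfloor>real p powr (1300 / 1301)\<rfloor> + nat \<lfloor>real p powr (239 / 500)\<rfloor>}"
        "n \<in> {1..nat \<lfloor>real p powr (1300 / 1301)\<rfloor> + nat \<lfloor>real p powr (333 / 1000)\<rfloor>}"
        "A \<subseteq> {1..nat \<lfloor>real p powr (1300 / 1301)\<rfloor> + nat \<lfloor>real p powr (26 / 625)\<rfloor>}"
        "A' \<subseteq> {1..nat \<lfloor>real p powr (1300 / 1301)\<rfloor> + nat \<lfloor>real p powr (26 / 625)\<rfloor>}"
        "card A = 23" "card A' = 23"
        "[fact m * fact n + ((\<Sum>h\<in>A. fact h) + (\<Sum>h\<in>A'. fact h)) = l - 1] (mod int p)"
        using factorial_sums_represent_residue[OF \<open>prime p\<close> \<open>2 < p\<close> adm(1,5-8)] by blast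
      show thesis
        using that[OF _ _ _ _ *(5) _ *(6) _ *(7)] le[OF *(1)] le[OF *(2)] le[OF subsetD[OF *(3)]]
          le[OF subsetD[OF *(4)]] adm(2-4) unfolding T_def by blast
    qed
    have "finite A" "finite A'" using A(1) A'(1) by (auto intro: card_ge_0_finite)
    \<comment> \<open>The sets \<open>A\<close> and \<open>A'\<close> may overlap, so they are
      enumerated separately, by \<open>1..23\<close> and \<open>24..46\<close>; index
      \<open>47\<close> remains for the value \<open>1\<close>.\<close>
    then obtain b b' where b: "bij_betw b {1..23::nat} A" and b': "bij_betw b' {24..46::nat} A'"
      using finite_same_card_bij[of "{1..23::nat}" A] finite_same_card_bij[of "{24..46::nat}" A'] A(1) A'(1)
      by auto
    define k where "k = (\<lambda>i. if i \<le> 23 then b i else if i \<le> 46 then b' i else 1)"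
    have T1: "1 \<le> T" using mn by linarith
    have kpos: "0 < k i \<and> real (k i) \<le> T" if "i \<in> {1..47}" for i
    proof -
      have "i \<in> {1..23} \<or> i \<in> {24..46} \<or> i = 47" using that by auto
      then consider "i \<in> {1..23}" | "i \<in> {24..46}" | "i = 47" by blast
      then show ?thesis
      proof cases
        case 1
        then show ?thesis using A(2)[of "b i"] bij_betwE[OF b] by (auto simp: k_def)
      next
        case 2
        then show ?thesis using A'(2)[of "b' i"] bij_betwE[OF b'] by (auto simp: k_def)
      qed (use T1 in \<open>simp add: k_def\<close>)
    qed
    have "(\<Sum>i=1..47. fact (k i) :: int) = (\<Sum>i\<in>{1..23} \<union> {24..46} \<union> {47}. fact (k i))"
      by (rule sum.cong) auto
    also have "\<dots> = (\<Sum>i\<in>{1..23}. fact (k i)) + (\<Sum>i\<in>{24..46}. fact (k i)) + fact (k 47)"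
      by (subst sum.union_disjoint; (subst sum.union_disjoint)?) auto
    also have "(\<Sum>i\<in>{1..23}. fact (k i)) = (\<Sum>i\<in>{1..23}. fact (b i) :: int)"
      by (rule sum.cong) (auto simp: k_def)
    also have "\<dots> = (\<Sum>h\<in>A. fact h)" by (rule sum.reindex_bij_betw[OF b])
    also have "(\<Sum>i\<in>{24..46}. fact (k i)) = (\<Sum>i\<in>{24..46}. fact (b' i) :: int)"
      by (rule sum.cong) (auto simp: k_def)
    also have "\<dots> = (\<Sum>h\<in>A'. fact h)" by (rule sum.reindex_bij_betw[OF b'])
    finally have "(\<Sum>i=1..47. fact (k i) :: int) = (\<Sum>h\<in>A. fact h) + (\<Sum>h\<in>A'. fact h) + 1"
      by (simp add: k_def)
    then have "[fact m * fact n + (\<Sum>i=1..47. fact (k i)) = l] (mod int p)"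
      using sol by (simp add: cong_iff_dvd_diff algebra_simps)
    moreover have "real (Max ({m, n} \<union> k ` {1..47})) \<le> T"
    proof -
      have "Max ({m, n} \<union> k ` {1..47}) \<in> {m, n} \<union> k ` {1..47}" by (intro Max_in) auto
      then show ?thesis using mn kpos by auto
    qed
    ultimately show ?thesis using mn kpos unfolding T_def by blast
  qed
  have "(2::real) > 0" by simp
  with main show ?thesis by blast
qed

end
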